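(* There exists a $9$-dimensional extremal $(0,1)$-matrix $A$ of order $2$ such that: (1) $A$ has more than one optimal hyperplane cover; and (2) if $\delta$ denotes the deficiency of $A$, then $A$ has an optimal hyperplane cover $\Lambda=(\lambda_{i,j})$ in which not all entries $\lambda_{i,j}$ are integer multiples of $\delta$.
   Context: A $d$-dimensional $(0,1)$-matrix of order $n$ is an array $(a_\alpha)$, $a_\alpha\in\{0,1\}$, indexed by $\alpha=(\alpha_1,\ldots,\alpha_d)$ with $\alpha_i\in\{0,\ldots,n-1\}$. Its support is the set of $\alpha$ with $a_\alpha=1$. The hyperplanes are the sets $\Gamma_{i,j}=\{\alpha:\alpha_i=j\}$. A polydiagonal in $A$ is an assignment of nonnegative real weights to the entries of the support of $A$ such that the sum of the weights over each hyperplane equals $1$. $A$ is extremal if $A$ has no polydiagonal, and after adding any new index to the support of $A$ the resulting matrix has a polydiagonal. A polyplex of weight $W$ in $A$ is an assignment of nonnegative real weights to the entries of the support of $A$ such that the sum over each hyperplane is at most $1$ and the sum of all weights is $W$; it is optimal if $W$ is maximum possible. The deficiency of an extremal matrix $A$ of order $n$ is $\delta=n-W$, where $W$ is the weight of an optimal polyplex in $A$. A hyperplane cover of $A$ is a $(d\times n)$-table $\Lambda=(\lambda_{i,j})$ of nonnegative real weights such that $\sum_{(i,j):\,\alpha\in\Gamma_{i,j}}\lambda_{i,j}\ge 1$ for every $\alpha$ in the support of $A$. Its weight is the sum of all $\lambda_{i,j}$; it is optimal if it has minimum weight among all hyperplane covers of $A$. *)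

theory Defs
  imports Complex_Main "HOL-Library.FuncSet"
begin

text \<open>
  Matrices, weightings and tables are extensional functions, so that two of them are equal
  exactly when their entries agree. Directions are numbered from 1 to \<open>d\<close>, coordinates
  from 0 to \<open>n - 1\<close>.
\<close>

definition indices :: "nat \<Rightarrow> nat \<Rightarrow> (nat \<Rightarrow> nat) set" where
  "indices d n = {1..d} \<rightarrow>\<^sub>E {..<n}"

definition zero_one_matrix :: "nat \<Rightarrow> nat \<Rightarrow> ((nat \<Rightarrow> nat) \<Rightarrow> nat) \<Rightarrow> bool" where
  "zero_one_matrix d n A \<longleftrightarrow> A \<in> indices d n \<rightarrow>\<^sub>E {0, 1}"

definition support :: "nat \<Rightarrow> nat \<Rightarrow> ((nat \<Rightarrow> nat) \<Rightarrow> nat) \<Rightarrow> (nat \<Rightarrow> nat) set" where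
  "support d n A = {\<alpha> \<in> indices d n. A \<alpha> = 1}"

definition hyperplane :: "nat \<Rightarrow> nat \<Rightarrow> nat \<Rightarrow> nat \<Rightarrow> (nat \<Rightarrow> nat) set" where
  "hyperplane d n i j = {\<alpha> \<in> indices d n. \<alpha> i = j}"

definition polydiagonal ::
    "nat \<Rightarrow> nat \<Rightarrow> ((nat \<Rightarrow> nat) \<Rightarrow> nat) \<Rightarrow> ((nat \<Rightarrow> nat) \<Rightarrow> real) \<Rightarrow> bool" where
  "polydiagonal d n A w \<longleftrightarrow>
     w \<in> support d n A \<rightarrow>\<^sub>E {0..} \<and>
     (\<forall>i\<in>{1..d}. \<forall>j<n. (\<Sum>\<alpha> \<in> support d n A \<inter> hyperplane d n i j. w \<alpha>) = 1)"

definition extremal :: "nat \<Rightarrow> nat \<Rightarrow> ((nat \<Rightarrow> nat) \<Rightarrow> nat) \<Rightarrow> bool" where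
  "extremal d n A \<longleftrightarrow>
     (\<nexists>w. polydiagonal d n A w) \<and>
     (\<forall>\<beta> \<in> indices d n - support d n A. \<exists>w. polydiagonal d n (A(\<beta> := 1)) w)"

definition polyplex ::
    "nat \<Rightarrow> nat \<Rightarrow> ((nat \<Rightarrow> nat) \<Rightarrow> nat) \<Rightarrow> real \<Rightarrow> ((nat \<Rightarrow> nat) \<Rightarrow> real) \<Rightarrow> bool" where
  "polyplex d n A W w \<longleftrightarrow>
     w \<in> support d n A \<rightarrow>\<^sub>E {0..} \<and>
     (\<forall>i\<in>{1..d}. \<forall>j<n. (\<Sum>\<alpha> \<in> support d n A \<inter> hyperplane d n i j. w \<alpha>) \<le> 1) \<and>
     (\<Sum>\<alpha> \<in> support d n A. w \<alpha>) = W"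

definition optimal_polyplex ::
    "nat \<Rightarrow> nat \<Rightarrow> ((nat \<Rightarrow> nat) \<Rightarrow> nat) \<Rightarrow> real \<Rightarrow> ((nat \<Rightarrow> nat) \<Rightarrow> real) \<Rightarrow> bool" where
  "optimal_polyplex d n A W w \<longleftrightarrow>
     polyplex d n A W w \<and> (\<forall>W' w'. polyplex d n A W' w' \<longrightarrow> W' \<le> W)"

definition deficiency :: "nat \<Rightarrow> nat \<Rightarrow> ((nat \<Rightarrow> nat) \<Rightarrow> nat) \<Rightarrow> real" where
  "deficiency d n A = real n - (THE W. \<exists>w. optimal_polyplex d n A W w)"

lemma deficiency_eq:
  assumes "optimal_polyplex d n A W w"
  shows "deficiency d n A = real n - W"
proof -
  have "(THE W. \<exists>w. optimal_polyplex d n A W w) = W"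
    using assms by (intro the_equality) (auto simp: optimal_polyplex_def intro: antisym)
  then show ?thesis by (simp add: deficiency_def)
qed

definition hyperplane_cover ::
    "nat \<Rightarrow> nat \<Rightarrow> ((nat \<Rightarrow> nat) \<Rightarrow> nat) \<Rightarrow> (nat \<times> nat \<Rightarrow> real) \<Rightarrow> bool" where
  "hyperplane_cover d n A \<Lambda> \<longleftrightarrow>
     \<Lambda> \<in> {1..d} \<times> {..<n} \<rightarrow>\<^sub>E {0..} \<and>
     (\<forall>\<alpha> \<in> support d n A.
        (\<Sum>(i, j) \<in> {(i, j) \<in> {1..d} \<times> {..<n}. \<alpha> \<in> hyperplane d n i j}. \<Lambda> (i, j)) \<ge> 1)"

definition cover_weight :: "nat \<Rightarrow> nat \<Rightarrow> (nat \<times> nat \<Rightarrow> real) \<Rightarrow> real" where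
  "cover_weight d n \<Lambda> = (\<Sum>(i, j) \<in> {1..d} \<times> {..<n}. \<Lambda> (i, j))"

definition optimal_cover ::
    "nat \<Rightarrow> nat \<Rightarrow> ((nat \<Rightarrow> nat) \<Rightarrow> nat) \<Rightarrow> (nat \<times> nat \<Rightarrow> real) \<Rightarrow> bool" where
  "optimal_cover d n A \<Lambda> \<longleftrightarrow>
     hyperplane_cover d n A \<Lambda> \<and>
     (\<forall>\<Lambda>'. hyperplane_cover d n A \<Lambda>' \<longrightarrow> cover_weight d n \<Lambda> \<le> cover_weight d n \<Lambda>')"

end

(* Order 2: write an index as the 0-1 vector of a set of voters. A weighted majority game with
   voter weights v of odd total 2q - 1 and quota q gives an extremal matrix, because complementary
   voter sets are never both losing; its normalised weights v / q form a cover of weight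
   (2q - 1) / q < 2. For v = (13,7,6,6,4,4,4,3,2) no minimal winning coalition of total exactly 25
   separates the last two voters, so their weights may be levelled to 5/2, 5/2, which gives a
   second cover of the same weight 49/25. Both are optimal by LP duality: the 8 coalitions below
   carry a polyplex of weight 49/25, so that the deficiency is 1/25. *)
theory Submission
  imports Defs
begin

section \<open>Duality of polyplexes and covers\<close>

lemma finite_indices [simp]: "finite (indices d n)"
  unfolding indices_def by (intro finite_PiE) auto

lemma finite_support [simp]: "finite (support d n A)"
  unfolding support_def by simp

text \<open>In each direction \<open>i\<close> the only hyperplane through \<alpha> is the one with
  \<open>j = \<alpha> i\<close>, so the incident pairs are the graph of \<alpha>.\<close>

lemma sum_hyperplanes_containing:
  assumes "\<alpha> \<in> indices d n"
  shows "(\<Sum>(i, j) \<in> {(i, j) \<in> {1..d} \<times> {..<n}. \<alpha> \<in> hyperplane d n i j}. f (i, j))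
           = (\<Sum>i = 1..d. f (i, \<alpha> i))"
proof -
  have "{(i, j) \<in> {1..d} \<times> {..<n}. \<alpha> \<in> hyperplane d n i j} = (\<lambda>i. (i, \<alpha> i)) ` {1..d}"
    using assms by (auto simp: hyperplane_def indices_def)
  moreover have "inj_on (\<lambda>i. (i, \<alpha> i)) {1..d}"
    by (auto simp: inj_on_def)
  ultimately show ?thesis
    by (simp add: sum.reindex)
qed

text \<open>Weak LP duality by double counting \<open>w \<alpha> * \<Lambda> ij\<close> over
  incident pairs: summed by index it is at least \<open>W\<close> since \<Lambda> covers, and summed
  by hyperplane it is at most the cover weight since \<open>w\<close> packs.\<close>

lemma polyplex_weight_le_cover_weight:
  assumes p: "polyplex d n A W w" and c: "hyperplane_cover d n A \<Lambda>"
  shows "W \<le> cover_weight d n \<Lambda>"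
proof -
  let ?S = "support d n A" and ?I = "{1..d} \<times> {..<n}"
  let ?H = "\<lambda>ij. hyperplane d n (fst ij) (snd ij)"
  have nonneg: "w \<alpha> \<ge> 0" if "\<alpha> \<in> ?S" for \<alpha>
    using p that by (auto simp: polyplex_def)
  have "W = (\<Sum>\<alpha>\<in>?S. w \<alpha>)"
    using p by (simp add: polyplex_def)
  also have "\<dots> \<le> (\<Sum>\<alpha>\<in>?S. w \<alpha> * (\<Sum>ij\<in>{ij \<in> ?I. \<alpha> \<in> ?H ij}. \<Lambda> ij))"
  proof (rule sum_mono)
    fix \<alpha> assume \<alpha>: "\<alpha> \<in> ?S"
    then have "1 \<le> (\<Sum>ij\<in>{ij \<in> ?I. \<alpha> \<in> ?H ij}. \<Lambda> ij)"
      using c unfolding hyperplane_cover_def case_prod_unfold prod.collapse by blast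
    then show "w \<alpha> \<le> w \<alpha> * (\<Sum>ij\<in>{ij \<in> ?I. \<alpha> \<in> ?H ij}. \<Lambda> ij)"
      using nonneg[OF \<alpha>] by (metis mult.right_neutral mult_left_mono)
  qed
  also have "\<dots> = (\<Sum>\<alpha>\<in>?S. \<Sum>ij\<in>{ij \<in> ?I. \<alpha> \<in> ?H ij}. w \<alpha> * \<Lambda> ij)"
    by (simp add: sum_distrib_left)
  also have "\<dots> = (\<Sum>ij\<in>?I. \<Sum>\<alpha>\<in>{\<alpha> \<in> ?S. \<alpha> \<in> ?H ij}. w \<alpha> * \<Lambda> ij)"
    by (rule sum.swap_restrict) auto
  also have "\<dots> = (\<Sum>ij\<in>?I. \<Lambda> ij * (\<Sum>\<alpha>\<in>?S \<inter> ?H ij. w \<alpha>))"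
    by (simp add: sum_distrib_left mult.commute Int_def)
  also have "\<dots> \<le> (\<Sum>ij\<in>?I. \<Lambda> ij * 1)"
  proof (intro sum_mono mult_left_mono)
    fix ij assume ij: "ij \<in> ?I"
    show "(\<Sum>\<alpha>\<in>?S \<inter> ?H ij. w \<alpha>) \<le> 1"
      using p ij by (auto simp: polyplex_def)
    show "0 \<le> \<Lambda> ij"
      using c ij by (auto simp: hyperplane_cover_def)
  qed
  finally show ?thesis
    by (simp add: cover_weight_def case_prod_unfold)
qed

lemma optimal_if_equal_weight:
  assumes "polyplex d n A W w" "hyperplane_cover d n A \<Lambda>" "cover_weight d n \<Lambda> = W"
  shows "optimal_polyplex d n A W w" "optimal_cover d n A \<Lambda>"
  using assms polyplex_weight_le_cover_weight
  by (force simp: optimal_polyplex_def optimal_cover_def)+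

text \<open>The \<open>n\<close> hyperplanes of direction 1 partition the support, each with mass 1;
  direction 1 exists because \<open>1 \<le> d\<close>. With weak duality, a cover of weight below
  \<open>n\<close> then excludes polydiagonals.\<close>

lemma polydiagonal_imp_polyplex:
  assumes w: "polydiagonal d n A w" and d: "1 \<le> d"
  shows "polyplex d n A (real n) w"
proof -
  let ?S = "support d n A"
  have "(\<Sum>\<alpha>\<in>?S. w \<alpha>) = (\<Sum>j<n. \<Sum>\<alpha>\<in>{\<alpha> \<in> ?S. \<alpha> 1 = j}. w \<alpha>)"
  proof (rule sum.group[symmetric])
    show "(\<lambda>\<alpha>. \<alpha> 1) ` ?S \<subseteq> {..<n}"
      using d by (auto simp: support_def indices_def)
  qed simp_all
  also have "\<dots> = (\<Sum>j<n. \<Sum>\<alpha>\<in>?S \<inter> hyperplane d n 1 j. w \<alpha>)"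
    by (intro sum.cong) (auto simp: support_def hyperplane_def)
  also have "\<dots> = real n"
    using w d by (simp add: polydiagonal_def)
  finally show ?thesis
    using w by (simp add: polydiagonal_def polyplex_def)
qed

text \<open>Masses at coinciding points add up, so \<open>t\<close> may be non-injective. Below,
  this spares a proof that the chosen coalitions are distinct.\<close>

lemma sum_point_masses:
  fixes c :: "'k \<Rightarrow> 'c::comm_monoid_add"
  assumes "finite B" "finite K"
  shows "(\<Sum>\<alpha>\<in>B. \<Sum>k\<in>K. if t k = \<alpha> then c k else 0) = (\<Sum>k\<in>K. if t k \<in> B then c k else 0)"
  by (subst sum.swap) (use assms in \<open>simp add: sum.delta\<close>)

section \<open>Matrices of order 2 from weighted majority games\<close>

definition threshold_matrix :: "nat \<Rightarrow> (nat \<Rightarrow> nat) \<Rightarrow> nat \<Rightarrow> (nat \<Rightarrow> nat) \<Rightarrow> nat" where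
  "threshold_matrix d v q =
     restrict (\<lambda>\<alpha>. of_bool (q \<le> (\<Sum>i = 1..d. v i * \<alpha> i))) (indices d 2)"

lemma zero_one_threshold_matrix: "zero_one_matrix d 2 (threshold_matrix d v q)"
  by (auto simp: zero_one_matrix_def threshold_matrix_def)

lemma support_threshold_matrix:
  "support d 2 (threshold_matrix d v q)
     = {\<alpha> \<in> indices d 2. q \<le> (\<Sum>i = 1..d. v i * \<alpha> i)}"
  by (auto simp: support_def threshold_matrix_def)

text \<open>Only the hyperplanes with coordinate 1 (voter \<open>i\<close> is present) carry weight.
  The weights are real, unlike those of \<open>threshold_matrix\<close>, to admit the levelled value
  5/2.\<close>

definition weight_cover :: "nat \<Rightarrow> (nat \<Rightarrow> real) \<Rightarrow> real \<Rightarrow> nat \<times> nat \<Rightarrow> real" where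
  "weight_cover d u q =
     restrict (\<lambda>(i, j). if j = 1 then u i / q else 0) ({1..d} \<times> {..<2})"

text \<open>Stated for any matrix \<open>A\<close>, since the second cover uses weights other than
  those that define the game.\<close>

lemma hyperplane_cover_weight_cover:
  assumes u: "\<And>i. i \<in> {1..d} \<Longrightarrow> 0 \<le> u i" and q: "0 < q"
    and ge: "\<And>\<alpha>. \<alpha> \<in> support d 2 A \<Longrightarrow> q \<le> (\<Sum>i = 1..d. u i * real (\<alpha> i))"
  shows "hyperplane_cover d 2 A (weight_cover d u q)"
  unfolding hyperplane_cover_def
proof (intro conjI ballI)
  show "weight_cover d u q \<in> {1..d} \<times> {..<2} \<rightarrow>\<^sub>E {0..}"
    using u q by (auto simp: weight_cover_def)
next
  fix \<alpha> assume \<alpha>: "\<alpha> \<in> support d 2 A"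
  then have ind: "\<alpha> \<in> indices d 2"
    by (simp add: support_def)
  have "1 \<le> (\<Sum>i = 1..d. u i * real (\<alpha> i)) / q"
    using ge[OF \<alpha>] q by simp
  also have "\<dots> = (\<Sum>i = 1..d. weight_cover d u q (i, \<alpha> i))"
    unfolding sum_divide_distrib
  proof (rule sum.cong)
    fix i assume i: "i \<in> {1..d}"
    then have "\<alpha> i < 2"
      using ind by (auto simp: indices_def)
    then have "\<alpha> i = 0 \<or> \<alpha> i = 1"
      by linarith
    then show "u i * real (\<alpha> i) / q = weight_cover d u q (i, \<alpha> i)"
      using i by (auto simp: weight_cover_def)
  qed simp
  finally show "1 \<le> (\<Sum>(i, j) \<in> {(i, j) \<in> {1..d} \<times> {..<2}. \<alpha> \<in> hyperplane d 2 i j}.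
      weight_cover d u q (i, j))"
    by (simp only: sum_hyperplanes_containing[OF ind])
qed

lemma cover_weight_weight_cover:
  "cover_weight d 2 (weight_cover d u q) = (\<Sum>i = 1..d. u i) / q"
proof -
  have "cover_weight d 2 (weight_cover d u q)
      = (\<Sum>i = 1..d. \<Sum>j<2. weight_cover d u q (i, j))"
    by (simp add: cover_weight_def sum.cartesian_product)
  also have "\<dots> = (\<Sum>i = 1..d. u i / q)"
    by (intro sum.cong) (simp_all add: weight_cover_def numeral_2_eq_2)
  finally show ?thesis
    by (simp add: sum_divide_distrib)
qed

lemma extremal_threshold_matrix:
  assumes total: "(\<Sum>i = 1..d. v i) + 1 = 2 * q"
  shows "extremal d 2 (threshold_matrix d v q)"
  unfolding extremal_def
proof (intro conjI ballI)
  let ?A = "threshold_matrix d v q"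
  let ?S = "support d 2 ?A"
  have q: "0 < q"
    using total by simp
  \<comment> \<open>For \<open>d = 0\<close> the total is 0, and \<open>1 = 2 * q\<close> fails by
    parity.\<close>
  have d: "1 \<le> d"
  proof (rule ccontr)
    assume "\<not> 1 \<le> d"
    then have "1 = 2 * q"
      using total by simp
    then show False
      by presburger
  qed
  show "\<nexists>w. polydiagonal d 2 ?A w"
  proof
    assume "\<exists>w. polydiagonal d 2 ?A w"
    then obtain w where "polyplex d 2 ?A 2 w"
      using polydiagonal_imp_polyplex[OF _ d] by fastforce
    moreover have "hyperplane_cover d 2 ?A (weight_cover d (\<lambda>i. real (v i)) (real q))"
      using q by (intro hyperplane_cover_weight_cover)
        (simp_all add: support_threshold_matrix flip: of_nat_mult of_nat_sum)
    ultimately have "2 \<le> (\<Sum>i = 1..d. real (v i)) / real q"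
      by (metis polyplex_weight_le_cover_weight cover_weight_weight_cover)
    moreover have "(\<Sum>i = 1..d. real (v i)) = 2 * real q - 1"
      using total by (simp flip: of_nat_sum)
    ultimately show False
      using q by (simp add: field_simps)
  qed
next
  let ?A = "threshold_matrix d v q"
  let ?S = "support d 2 ?A"
  fix \<beta> assume \<beta>: "\<beta> \<in> indices d 2 - ?S"
  \<comment> \<open>The complementary coalition: \<beta> has weight at most \<open>q - 1\<close>, so
    \<gamma> has at least \<open>2 * q - 1 - (q - 1) = q\<close> and wins.\<close>
  define \<gamma> where "\<gamma> = restrict (\<lambda>i. 1 - \<beta> i) {1..d}"
  have \<beta>2: "\<beta> i < 2" if "i \<in> {1..d}" for i
    using \<beta> that by (auto simp: indices_def)
  have \<gamma>: "\<gamma> \<in> indices d 2"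
    by (auto simp: \<gamma>_def indices_def)
  have "(\<Sum>i = 1..d. v i * \<beta> i) + (\<Sum>i = 1..d. v i * \<gamma> i) = (\<Sum>i = 1..d. v i)"
    unfolding sum.distrib[symmetric]
  proof (rule sum.cong)
    fix i assume i: "i \<in> {1..d}"
    then have "\<beta> i + \<gamma> i = 1"
      using \<beta>2[OF i] by (simp add: \<gamma>_def)
    then show "v i * \<beta> i + v i * \<gamma> i = v i"
      by (simp flip: distrib_left)
  qed simp
  moreover have "(\<Sum>i = 1..d. v i * \<beta> i) < q"
    using \<beta> by (auto simp: support_threshold_matrix)
  ultimately have "\<gamma> \<in> ?S"
    using \<gamma> total by (simp add: support_threshold_matrix)
  moreover have supp: "support d 2 (?A(\<beta> := 1)) = insert \<beta> ?S"
    using \<beta> by (auto simp: support_def)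
  ultimately have sub: "{\<beta>, \<gamma>} \<subseteq> support d 2 (?A(\<beta> := 1))"
    by simp
  have \<beta>\<gamma>: "\<beta> \<noteq> \<gamma>"
    using \<beta> \<open>\<gamma> \<in> ?S\<close> by auto
  define w :: "(nat \<Rightarrow> nat) \<Rightarrow> real"
    where "w = restrict (\<lambda>\<alpha>. of_bool (\<alpha> \<in> {\<beta>, \<gamma>})) (support d 2 (?A(\<beta> := 1)))"
  have "polydiagonal d 2 (?A(\<beta> := 1)) w"
    unfolding polydiagonal_def
  proof (intro conjI ballI allI impI)
    show "w \<in> support d 2 (?A(\<beta> := 1)) \<rightarrow>\<^sub>E {0..}"
      by (auto simp: w_def)
  next
    fix i j assume i: "i \<in> {1..d}" and j: "j < (2::nat)"
    let ?T = "support d 2 (?A(\<beta> := 1)) \<inter> hyperplane d 2 i j"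
    have "(\<Sum>\<alpha>\<in>?T. w \<alpha>) = (\<Sum>\<alpha>\<in>?T. of_bool (\<alpha> \<in> {\<beta>, \<gamma>}))"
      by (intro sum.cong) (auto simp: w_def)
    also have "\<dots> = real (card {\<alpha> \<in> ?T. \<alpha> \<in> {\<beta>, \<gamma>}})"
      by (simp add: of_bool_def flip: sum.inter_filter)
    \<comment> \<open>\<beta> and \<gamma> differ in every coordinate, so each hyperplane contains
      exactly one of them and unit masses on the two form a polydiagonal.\<close>
    also have "{\<alpha> \<in> ?T. \<alpha> \<in> {\<beta>, \<gamma>}} = (if \<beta> i = j then {\<beta>} else {\<gamma>})"
    proof -
      have "\<gamma> i = 1 - \<beta> i"
        using i by (simp add: \<gamma>_def)
      then have "\<gamma> i = j \<longleftrightarrow> \<beta> i \<noteq> j"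
        using \<beta>2[OF i] j by presburger
      then show ?thesis
        using sub \<beta> \<gamma> by (auto simp: hyperplane_def)
    qed
    also have "real (card \<dots>) = 1"
      by simp
    finally show "(\<Sum>\<alpha>\<in>?T. w \<alpha>) = 1" .
  qed
  then show "\<exists>w. polydiagonal d 2 (?A(\<beta> := 1)) w"
    by blast
qed

section \<open>The game with quota 25\<close>

definition voter_weight :: "nat \<Rightarrow> nat" where
  "voter_weight i = [13, 7, 6, 6, 4, 4, 4, 3, 2] ! (i - 1)"

definition levelled_weight :: "nat \<Rightarrow> real" where
  "levelled_weight i = [13, 7, 6, 6, 4, 4, 4, 5/2, 5/2] ! (i - 1)"

definition game :: "(nat \<Rightarrow> nat) \<Rightarrow> nat" where
  "game = threshold_matrix 9 voter_weight 25"

lemma directions: "{1..9} = {1, 2, 3, 4, 5, 6, 7, 8, 9::nat}"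
  by auto

lemma sum_directions:
  "(\<Sum>i = 1..9. f i) = f 1 + f 2 + f 3 + f 4 + f 5 + f 6 + f 7 + f 8 + f (9::nat)"
  unfolding directions by (simp add: add_ac)

text \<open>Both sides are doubled to keep 5/2 within the naturals. Levelling changes the doubled
  sum by \<open>k - h\<close>, so it loses only for \<open>h = 1\<close>, \<open>k = 0\<close>.
  There the other seven voters must reach 23 rather than 22, which holds because no subset of them
  weighs exactly 22.\<close>

lemma voters_8_9_not_separated:
  fixes a b c d e f g h k :: nat
  assumes "25 \<le> 13*a + 7*b + 6*c + 6*d + 4*e + 4*f + 4*g + 3*h + 2*k"
    and "a < 2" "b < 2" "c < 2" "d < 2" "e < 2" "f < 2" "g < 2" "h < 2" "k < 2"
  shows "50 \<le> 26*a + 14*b + 12*c + 12*d + 8*e + 8*f + 8*g + 5*h + 5*k"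
proof -
  have bit: "x = 0 \<or> x = 1" if "x < 2" for x :: nat
    using that by linarith
  show ?thesis
  proof (cases "h = 1 \<and> k = 0")
    case True
    then have "22 \<le> 13*a + 7*b + 6*(c + d) + 4*(e + f + g)"
      using assms(1) by simp
    \<comment> \<open>Grouping voters of equal weight leaves 48 cases for the finite check.\<close>
    moreover have "13*a + 7*b + 6*x + 4*y \<noteq> 22" if "x \<in> {0, 1, 2}" "y \<in> {0, 1, 2, 3}" for x y
      using bit[OF assms(2)] bit[OF assms(3)] that by auto
    moreover have "c + d \<in> {0, 1, 2}" "e + f + g \<in> {0, 1, 2, 3}"
      unfolding insert_iff empty_iff using assms(4-8) by linarith+
    ultimately have "22 < 13*a + 7*b + 6*(c + d) + 4*(e + f + g)"
      by (metis le_neq_implies_less)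
    then show ?thesis
      using True by simp
  next
    case False
    then have "h = 0 \<or> k = 1"
      using bit[OF assms(9)] bit[OF assms(10)] by auto
    then show ?thesis
      using assms(1,9) by (elim disjE) linarith+
  qed
qed

section \<open>Two covers of weight 49/25\<close>

lemma cover_voter_weight:
  "hyperplane_cover 9 2 game (weight_cover 9 (\<lambda>i. real (voter_weight i)) 25)"
proof (rule hyperplane_cover_weight_cover)
  fix \<alpha> assume "\<alpha> \<in> support 9 2 game"
  then have "real 25 \<le> real (\<Sum>i = 1..9. voter_weight i * \<alpha> i)"
    unfolding game_def support_threshold_matrix of_nat_le_iff by blast
  then show "25 \<le> (\<Sum>i = 1..9. real (voter_weight i) * real (\<alpha> i))"
    by simp
qed simp_all

lemma cover_levelled_weight:
  "hyperplane_cover 9 2 game (weight_cover 9 levelled_weight 25)"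
proof (rule hyperplane_cover_weight_cover)
  show "0 \<le> levelled_weight i" if "i \<in> {1..9}" for i
    using that unfolding directions by (auto simp: levelled_weight_def)
next
  fix \<alpha> assume \<alpha>: "\<alpha> \<in> support 9 2 game"
  then have bits: "\<alpha> i < 2" if "i \<in> {1..9}" for i
    using that by (auto simp: support_def indices_def)
  have "25 \<le> (\<Sum>i = 1..9. voter_weight i * \<alpha> i)"
    using \<alpha> by (simp add: game_def support_threshold_matrix)
  then have "25 \<le> 13 * \<alpha> 1 + 7 * \<alpha> 2 + 6 * \<alpha> 3 + 6 * \<alpha> 4 + 4 * \<alpha> 5 + 4 * \<alpha> 6 + 4 * \<alpha> 7
      + 3 * \<alpha> 8 + 2 * \<alpha> 9"
    unfolding sum_directions by (simp add: voter_weight_def)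
  then have "50 \<le> 26 * \<alpha> 1 + 14 * \<alpha> 2 + 12 * \<alpha> 3 + 12 * \<alpha> 4 + 8 * \<alpha> 5 + 8 * \<alpha> 6 + 8 * \<alpha> 7
      + 5 * \<alpha> 8 + 5 * \<alpha> 9"
    by (rule voters_8_9_not_separated) (rule bits, simp)+
  then have "real 50 \<le> real (26 * \<alpha> 1 + 14 * \<alpha> 2 + 12 * \<alpha> 3 + 12 * \<alpha> 4 + 8 * \<alpha> 5 + 8 * \<alpha> 6
      + 8 * \<alpha> 7 + 5 * \<alpha> 8 + 5 * \<alpha> 9)"
    by (simp only: of_nat_le_iff)
  then show "25 \<le> (\<Sum>i = 1..9. levelled_weight i * real (\<alpha> i))"
    unfolding sum_directions by (simp add: levelled_weight_def)
qed simp

section \<open>A polyplex of weight 49/25\<close>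

text \<open>Complementary slackness guides the choice: each coalition weighs exactly 25 and contains
  both or neither of voters 8 and 9, so both covers are tight on it.\<close>

definition coalition :: "nat \<Rightarrow> nat set" where
  "coalition k =
     [{1, 3, 4}, {1, 5, 6, 7}, {1, 2, 8, 9}, {2, 3, 5, 6, 7}, {2, 4, 5, 6, 7},
      {3, 4, 5, 6, 8, 9}, {3, 4, 5, 7, 8, 9}, {3, 4, 6, 7, 8, 9}] ! k"

definition coalition_index :: "nat \<Rightarrow> nat \<Rightarrow> nat" where
  "coalition_index k = restrict (\<lambda>i. of_bool (i \<in> coalition k)) {1..9}"

text \<open>The masses are balanced: the coalitions containing any given voter have total mass
  exactly 1.\<close>

definition coalition_mass :: "nat \<Rightarrow> real" where
  "coalition_mass k = [7, 5, 13, 6, 6, 4, 4, 4] ! k / 25"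

definition game_polyplex :: "(nat \<Rightarrow> nat) \<Rightarrow> real" where
  "game_polyplex = restrict
     (\<lambda>\<alpha>. \<Sum>k<8. if coalition_index k = \<alpha> then coalition_mass k else 0) (support 9 2 game)"

lemma lessThan_8: "{..<8} = {0, 1, 2, 3, 4, 5, 6, 7::nat}"
  by auto

lemma coalition_index_in_support:
  assumes "k < 8"
  shows "coalition_index k \<in> support 9 2 game"
proof -
  have "k \<in> {0, 1, 2, 3, 4, 5, 6, 7}"
    using assms unfolding lessThan_iff[symmetric] lessThan_8 .
  then have "(\<Sum>i \<in> {1..9} \<inter> coalition k. voter_weight i) = 25"
    by (elim insertE; simp add: voter_weight_def coalition_def)
  moreover have "(\<Sum>i = 1..9. voter_weight i * coalition_index k i)
      = (\<Sum>i \<in> {1..9} \<inter> coalition k. voter_weight i)"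
    by (rule sum.mono_neutral_cong_right) (auto simp: coalition_index_def)
  moreover have "coalition_index k \<in> indices 9 2"
    by (auto simp: coalition_index_def indices_def)
  ultimately show ?thesis
    by (simp add: game_def support_threshold_matrix)
qed

lemma sum_game_polyplex:
  assumes "B \<subseteq> support 9 2 game"
  shows "(\<Sum>\<alpha>\<in>B. game_polyplex \<alpha>)
           = (\<Sum>k<8. if coalition_index k \<in> B then coalition_mass k else 0)"
proof -
  have "(\<Sum>\<alpha>\<in>B. game_polyplex \<alpha>)
      = (\<Sum>\<alpha>\<in>B. \<Sum>k<8. if coalition_index k = \<alpha> then coalition_mass k else 0)"
    using assms by (intro sum.cong) (auto simp: game_polyplex_def)
  also have "\<dots> = (\<Sum>k<8. if coalition_index k \<in> B then coalition_mass k else 0)"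
    using finite_subset[OF assms] by (intro sum_point_masses) simp_all
  finally show ?thesis .
qed

lemma polyplex_game_polyplex: "polyplex 9 2 game (49/25) game_polyplex"
  unfolding polyplex_def
proof (intro conjI ballI allI impI)
  have "0 \<le> coalition_mass k" if "k < 8" for k
    using that by (auto simp: coalition_mass_def less_Suc_eq numeral_eq_Suc)
  then show "game_polyplex \<in> support 9 2 game \<rightarrow>\<^sub>E {0..}"
    by (auto simp: game_polyplex_def intro!: sum_nonneg)
next
  fix i j :: nat assume i: "i \<in> {1..9}" and j: "j < 2"
  let ?S = "support 9 2 game"
  have "(\<Sum>\<alpha>\<in>?S \<inter> hyperplane 9 2 i j. game_polyplex \<alpha>)
      = (\<Sum>k<8. if coalition_index k \<in> ?S \<inter> hyperplane 9 2 i j then coalition_mass k else 0)"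
    by (rule sum_game_polyplex) simp
  also have "\<dots> = (\<Sum>k<8. if of_bool (i \<in> coalition k) = j then coalition_mass k else 0)"
    using i coalition_index_in_support
    by (intro sum.cong) (auto simp: hyperplane_def coalition_index_def support_def)
  \<comment> \<open>The sum is 1 for \<open>j = 1\<close> and \<open>49/25 - 1 = 24/25\<close> for
    \<open>j = 0\<close>.\<close>
  also have "\<dots> \<le> 1"
  proof -
    have "j = 0 \<or> j = 1"
      using j by linarith
    moreover have "i \<in> {1, 2, 3, 4, 5, 6, 7, 8, 9}"
      using i unfolding directions .
    ultimately show ?thesis
      unfolding lessThan_8
      by (elim disjE insertE; simp add: coalition_def coalition_mass_def)
  qed
  finally show "(\<Sum>\<alpha>\<in>?S \<inter> hyperplane 9 2 i j. game_polyplex \<alpha>) \<le> 1" .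
next
  have "(\<Sum>\<alpha>\<in>support 9 2 game. game_polyplex \<alpha>) = (\<Sum>k<8. coalition_mass k)"
    using coalition_index_in_support by (simp add: sum_game_polyplex)
  also have "\<dots> = 49/25"
    unfolding lessThan_8 by (simp add: coalition_mass_def)
  finally show "(\<Sum>\<alpha>\<in>support 9 2 game. game_polyplex \<alpha>) = 49/25" .
qed

theorem mainTheorem6:
  shows "\<exists>A :: (nat \<Rightarrow> nat) \<Rightarrow> nat.
    zero_one_matrix 9 2 A \<and> extremal 9 2 A \<and>
    (\<exists>\<Lambda> \<Lambda>'. optimal_cover 9 2 A \<Lambda> \<and> optimal_cover 9 2 A \<Lambda>' \<and> \<Lambda> \<noteq> \<Lambda>') \<and>
    (\<exists>\<Lambda>. optimal_cover 9 2 A \<Lambda> \<and>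
      \<not> (\<forall>i\<in>{1..9}. \<forall>j<2. \<exists>k::int. \<Lambda> (i, j) = of_int k * deficiency 9 2 A))"
proof -
  let ?\<Lambda> = "weight_cover 9 (\<lambda>i. real (voter_weight i)) 25"
  let ?\<Lambda>' = "weight_cover 9 levelled_weight 25"
  have "cover_weight 9 2 ?\<Lambda> = 49/25" "cover_weight 9 2 ?\<Lambda>' = 49/25"
    unfolding cover_weight_weight_cover sum_directions
    by (simp_all add: voter_weight_def levelled_weight_def)
  then have \<Lambda>: "optimal_cover 9 2 game ?\<Lambda>" and \<Lambda>': "optimal_cover 9 2 game ?\<Lambda>'"
    and "optimal_polyplex 9 2 game (49/25) game_polyplex"
    using optimal_if_equal_weight polyplex_game_polyplex cover_voter_weight cover_levelled_weight
    by blast+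
  then have deficiency: "deficiency 9 2 game = 1/25"
    by (simp add: deficiency_eq)
  have "?\<Lambda> (9, 1) = 2/25" and \<Lambda>'9: "?\<Lambda>' (9, 1) = 5/50"
    by (simp_all add: weight_cover_def voter_weight_def levelled_weight_def)
  then have ne: "?\<Lambda> \<noteq> ?\<Lambda>'"
    by auto
  \<comment> \<open>The levelled entry (5/2)/25 is 5/2 times the deficiency 1/25, so an integer
    multiple would give \<open>2 * k = 5\<close>.\<close>
  have "?\<Lambda>' (9, 1) \<noteq> of_int k * deficiency 9 2 game" for k :: int
  proof
    assume "?\<Lambda>' (9, 1) = of_int k * deficiency 9 2 game"
    then have "real_of_int (2 * k) = real_of_int 5"
      using \<Lambda>'9 deficiency by simp
    then have "2 * k = 5"
      by (simp only: of_int_eq_iff)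
    then show False
      by presburger
  qed
  then have "\<not> (\<forall>i\<in>{1..9}. \<forall>j<2. \<exists>k::int. ?\<Lambda>' (i, j) = of_int k * deficiency 9 2 game)"
    by (auto intro!: bexI[of _ 9] exI[of _ 1])
  moreover have "extremal 9 2 game"
    unfolding game_def
    by (rule extremal_threshold_matrix) (unfold sum_directions, simp add: voter_weight_def)
  moreover have "zero_one_matrix 9 2 game"
    unfolding game_def by (rule zero_one_threshold_matrix)
  ultimately show ?thesis
    using \<Lambda> \<Lambda>' ne by blast
qed

end
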